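(* Let $k\geq 2$ be an integer. For $n\geq 0$ let $ud(n)$, $dd(n)$, $uu(n)$, $du(n)$ denote, respectively, the numbers of up-down, down-down, up-up and down-up permutations of length $n$ that avoid both $1\mbox{-}3\mbox{-}2$ and $1\mbox{-}2\mbox{-}\cdots\mbox{-}k$, and let $UD(x)=\sum_{n\geq0}ud(n)x^n$, $DD(x)=\sum_{n\ge0}dd(n)x^n$, $UU(x)=\sum_{n\ge0}uu(n)x^n$, $DU(x)=\sum_{n\ge0}du(n)x^n$. Then, writing $U_r$ for $U_r\!\left(\frac{1}{2x}\right)$, (1) $UD(x)=\dfrac{xU_{k-3}}{U_{k-1}}$; (2) $DD(x)=\dfrac{x^{k-1}+U_{k-3}}{U_{k-1}}$; (3) $UU(x)=\dfrac{U_{k-3}}{U_{k-1}}$; (4) $DU(x)=\dfrac{x^{k-1}+U_{k-3}}{xU_{k-1}}-x$.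
   Context: A permutation of length $n$ is a word $\pi_1\cdots\pi_n$ containing each of $1,\dots,n$ exactly once. For a permutation $\tau$ of length $m$, the classical pattern $\tau$ (written with dashes between letters, e.g. $1\mbox{-}3\mbox{-}2$, $1\mbox{-}2\mbox{-}\cdots\mbox{-}k$) occurs in $\pi$ at indices $i_1<\dots<i_m$ if $\pi_{i_1}\cdots\pi_{i_m}$ is order-isomorphic to $\tau$; $\pi$ avoids $\tau$ if there is no occurrence. Thus $1\mbox{-}3\mbox{-}2$ is the classical pattern $132$ and $1\mbox{-}2\mbox{-}\cdots\mbox{-}k$ is an increasing subsequence of length $k$. For $n\ge2$: up-down permutations satisfy $\pi_1<\pi_2>\pi_3<\cdots$ and have odd length; up-up permutations satisfy $\pi_1<\pi_2>\pi_3<\cdots$ and have even length; down-up permutations satisfy $\pi_1>\pi_2<\pi_3>\cdots$ and have odd length; down-down permutations satisfy $\pi_1>\pi_2<\pi_3>\cdots$ and have even length. For $n=0,1$ none of these four classes has any element. $U_r$ denotes the Chebyshev polynomial of the second kind, $U_r(\cos\theta)=\frac{\sin((r+1)\theta)}{\sin\theta}$, so $U_{-1}(t)=0$, $U_0(t)=1$, $U_1(t)=2t$, $U_r(t)=2tU_{r-1}(t)-U_{r-2}(t)$. *)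

theory Defs
  imports
    "HOL-Combinatorics.Multiset_Permutations"
    "HOL-Computational_Algebra.Formal_Laurent_Series"
    Complex_Main
begin

definition order_isomorphic :: "nat list \<Rightarrow> nat list \<Rightarrow> bool" where
  "order_isomorphic u v \<longleftrightarrow> length u = length v \<and>
     (\<forall>i<length u. \<forall>j<length u. u ! i < u ! j \<longleftrightarrow> v ! i < v ! j)"

definition occurs_at :: "nat list \<Rightarrow> nat list \<Rightarrow> nat list \<Rightarrow> bool" where
  "occurs_at \<tau> \<pi> is \<longleftrightarrow> sorted_wrt (<) is \<and> set is \<subseteq> {..<length \<pi>} \<and>
     order_isomorphic (map (\<lambda>i. \<pi> ! i) is) \<tau>"

definition avoids :: "nat list \<Rightarrow> nat list \<Rightarrow> bool" where
  "avoids \<pi> \<tau> \<longleftrightarrow> (\<nexists>is. occurs_at \<tau> \<pi> is)"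

text \<open>List positions start at 0, so an initial ascent is a comparison at the even position 0.\<close>

definition alternating_from_up :: "nat list \<Rightarrow> bool" where
  "alternating_from_up \<pi> \<longleftrightarrow> (\<forall>i. Suc i < length \<pi> \<longrightarrow>
     (if even i then \<pi> ! i < \<pi> ! Suc i else \<pi> ! i > \<pi> ! Suc i))"

definition alternating_from_down :: "nat list \<Rightarrow> bool" where
  "alternating_from_down \<pi> \<longleftrightarrow> (\<forall>i. Suc i < length \<pi> \<longrightarrow>
     (if even i then \<pi> ! i > \<pi> ! Suc i else \<pi> ! i < \<pi> ! Suc i))"

text \<open>The two words in each name describe the first and the last step of the permutation;
  words of length 0 and 1 are excluded from all four classes.\<close>

definition up_down :: "nat list \<Rightarrow> bool" where
  "up_down \<pi> \<longleftrightarrow> length \<pi> \<ge> 2 \<and> odd (length \<pi>) \<and> alternating_from_up \<pi>"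

definition up_up :: "nat list \<Rightarrow> bool" where
  "up_up \<pi> \<longleftrightarrow> length \<pi> \<ge> 2 \<and> even (length \<pi>) \<and> alternating_from_up \<pi>"

definition down_up :: "nat list \<Rightarrow> bool" where
  "down_up \<pi> \<longleftrightarrow> length \<pi> \<ge> 2 \<and> odd (length \<pi>) \<and> alternating_from_down \<pi>"

definition down_down :: "nat list \<Rightarrow> bool" where
  "down_down \<pi> \<longleftrightarrow> length \<pi> \<ge> 2 \<and> even (length \<pi>) \<and> alternating_from_down \<pi>"

definition avoiders :: "nat \<Rightarrow> nat \<Rightarrow> nat list set" where
  "avoiders k n = {\<pi> \<in> permutations_of_set {1..n}. avoids \<pi> [1, 3, 2] \<and> avoids \<pi> [1..<Suc k]}"

definition ud :: "nat \<Rightarrow> nat \<Rightarrow> nat" where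
  "ud k n = card {\<pi> \<in> avoiders k n. up_down \<pi>}"

definition dd :: "nat \<Rightarrow> nat \<Rightarrow> nat" where
  "dd k n = card {\<pi> \<in> avoiders k n. down_down \<pi>}"

definition uu :: "nat \<Rightarrow> nat \<Rightarrow> nat" where
  "uu k n = card {\<pi> \<in> avoiders k n. up_up \<pi>}"

definition du :: "nat \<Rightarrow> nat \<Rightarrow> nat" where
  "du k n = card {\<pi> \<in> avoiders k n. down_up \<pi>}"

definition gen_fun :: "(nat \<Rightarrow> nat) \<Rightarrow> real fls" where
  "gen_fun a = fps_to_fls (Abs_fps (\<lambda>n. of_nat (a n)))"

text \<open>The index is an integer because \<open>U\<^sub>-\<^sub>1 = 0\<close> is needed; the value 0 at
  indices below -1 is a dummy.\<close>

function cheb_U :: "int \<Rightarrow> 'a::comm_ring_1 poly" where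
  "cheb_U r = (if r < 0 then 0 else if r = 0 then 1
               else [:0, 2:] * cheb_U (r - 1) - cheb_U (r - 2))"
  by auto
termination by (relation "measure (\<lambda>r. nat (r + 1))") auto

declare cheb_U.simps [simp del]

lemma cheb_U_minus_1: "cheb_U (-1) = 0"
  and cheb_U_0: "cheb_U 0 = 1"
  and cheb_U_1: "cheb_U 1 = [:0, 2:]"
  and cheb_U_rec: "r \<ge> 1 \<Longrightarrow> cheb_U r = [:0, 2:] * cheb_U (r - 1) - cheb_U (r - 2)"
  by (simp_all add: cheb_U.simps)

lemma cheb_U_cos:
  fixes \<theta> :: real
  assumes "r \<ge> -1"
  shows "poly (cheb_U r) (cos \<theta>) * sin \<theta> = sin ((of_int r + 1) * \<theta>)"
  using assms
proof (induction r rule: cheb_U.induct)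
  case (1 r)
  consider "r = -1" | "r = 0" | "r \<ge> 1" using "1.prems" by linarith
  then show ?case
  proof cases
    case 3
    have a: "poly (cheb_U (r - 1)) (cos \<theta>) * sin \<theta> = sin (of_int r * \<theta>)"
      using "1.IH"(1) 3 by simp
    have b: "poly (cheb_U (r - 2)) (cos \<theta>) * sin \<theta> = sin (of_int r * \<theta> - \<theta>)"
      using "1.IH"(2) 3 by (simp add: algebra_simps)
    have "poly (cheb_U r) (cos \<theta>) * sin \<theta> =
        2 * cos \<theta> * (poly (cheb_U (r - 1)) (cos \<theta>) * sin \<theta>) -
        poly (cheb_U (r - 2)) (cos \<theta>) * sin \<theta>"
      by (subst cheb_U_rec[OF 3]) (simp add: algebra_simps)
    also have "\<dots> = sin (of_int r * \<theta> + \<theta>)"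
      by (simp add: a b sin_add sin_diff)
    finally show ?thesis by (simp add: algebra_simps)
  qed (simp_all add: cheb_U_minus_1 cheb_U_0)
qed

text \<open>\<open>U\<^sub>r(1/(2x))\<close> in the field of formal Laurent series in \<open>x\<close>.\<close>

definition cheb_U_at :: "int \<Rightarrow> real fls" where
  "cheb_U_at r = poly (cheb_U r) (1 / (2 * fls_X))"

lemma cheb_U_at_rec:
  assumes "r \<ge> 1"
  shows "fls_X * cheb_U_at r = cheb_U_at (r - 1) - fls_X * cheb_U_at (r - 2)"
proof -
  have "cheb_U_at r = 2 * (1 / (2 * fls_X)) * cheb_U_at (r - 1) - cheb_U_at (r - 2)"
    unfolding cheb_U_at_def
    by (subst cheb_U_rec[OF assms]) (simp only: poly_diff poly_mult poly_pCons poly_0 mult_zero_right mult_zero_left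
      add_0_right add_0_left mult_ac)
  also have "2 * (1 / (2 * fls_X)) = 1 / (fls_X :: real fls)"
    by simp
  finally have "fls_X * cheb_U_at r =
      (fls_X * (1 / fls_X)) * cheb_U_at (r - 1) - fls_X * cheb_U_at (r - 2)"
    by (simp only: right_diff_distrib mult.assoc)
  also have "fls_X * (1 / fls_X) = (1 :: real fls)"
    by (metis divide_self_if fls_X_nonzero mult.right_neutral times_divide_eq_right)
  finally show ?thesis by simp
qed

lemma cheb_U_at_unit_part:
  "\<exists>g. g $ 0 = 1 \<and> fls_X ^ n * cheb_U_at (int n) = fps_to_fls g"
proof (induction n rule: less_induct)
  case (less n)
  consider "n = 0" | "n = 1" | m where "n = Suc (Suc m)"
    by (metis One_nat_def not0_implies_Suc)
  then show ?case
  proof cases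
    case 1
    then show ?thesis
      by (intro exI[of _ 1]) (simp add: cheb_U_at_def cheb_U_0)
  next
    case 2
    then show ?thesis
      using cheb_U_at_rec[of 1]
      by (intro exI[of _ 1]) (simp add: cheb_U_at_def cheb_U_0 cheb_U_minus_1)
  next
    case (3 m)
    obtain g where g: "g $ 0 = 1" "fls_X ^ m * cheb_U_at (int m) = fps_to_fls g"
      using less[of m] 3 by auto
    obtain h where h: "h $ 0 = 1" "fls_X ^ Suc m * cheb_U_at (int (Suc m)) = fps_to_fls h"
      using less[of "Suc m"] 3 by blast
    have "fls_X ^ n * cheb_U_at (int n) = fls_X ^ Suc m * (fls_X * cheb_U_at (int n))"
      by (simp add: 3 algebra_simps)
    also have "fls_X * cheb_U_at (int n) = cheb_U_at (int (Suc m)) - fls_X * cheb_U_at (int m)"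
      using cheb_U_at_rec[of "int n"] by (simp add: 3 algebra_simps)
    also have "fls_X ^ Suc m * (cheb_U_at (int (Suc m)) - fls_X * cheb_U_at (int m)) =
        fls_X ^ Suc m * cheb_U_at (int (Suc m)) - fls_X ^ 2 * (fls_X ^ m * cheb_U_at (int m))"
      by (simp add: algebra_simps power2_eq_square)
    also have "\<dots> = fps_to_fls (h - fps_X ^ 2 * g)"
      unfolding g h
      by (simp add: fps_to_fls_minus fls_times_fps_to_fls fps_to_fls_power)
    finally show ?thesis
      using h(1) by (intro exI[of _ "h - fps_X ^ 2 * g"]) simp
  qed
qed

lemma cheb_U_at_nonzero: "cheb_U_at (int n) \<noteq> 0"
  using cheb_U_at_unit_part[of n] by fastforce

end

theory Submission
  imports Defs "HOL-Library.Sublist"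
begin

text \<open>
  A nonempty permutation avoids 132 iff it has the form \<open>(u \<oplus> 1) \<ominus> v\<close> with \<open>u\<close> and \<open>v\<close> again
  permutations avoiding 132; a longest increasing subsequence is then either one of \<open>u\<close> followed
  by the maximum, or one of \<open>v\<close>. Since the maximum is a peak, the first step and the parity of the
  length of \<open>u\<close> determine each other. Hence, if \<open>A\<^sub>k\<close>, \<open>B\<^sub>k\<close> count words of odd and even length
  beginning with an ascent, \<open>D\<^sub>k\<close>, \<open>C\<^sub>k\<close> those beginning with a descent (lengths 0 and 1 belong to
  both kinds), then for \<open>k \<ge> 2\<close>
  \<open>A\<^sub>k = x + x A\<^sub>k\<^sub>-\<^sub>1 A\<^sub>k\<close>, \<open>B\<^sub>k = 1 + x A\<^sub>k\<^sub>-\<^sub>1 B\<^sub>k\<close>,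
  \<open>C\<^sub>k = 1 + x C\<^sub>k\<^sub>-\<^sub>1 A\<^sub>k\<close> and \<open>D\<^sub>k = x C\<^sub>k\<^sub>-\<^sub>1 B\<^sub>k\<close>, with \<open>A\<^sub>1 = 0\<close> and
  \<open>C\<^sub>1 = 1\<close>. The Chebyshev recurrence gives the solution
  \<open>A\<^sub>k = U\<^sub>k\<^sub>-\<^sub>2 / U\<^sub>k\<^sub>-\<^sub>1\<close>, \<open>x C\<^sub>k = (U\<^sub>k\<^sub>-\<^sub>2 + x\<^sup>k) / U\<^sub>k\<^sub>-\<^sub>1\<close>,
  \<open>A\<^sub>k = x B\<^sub>k\<close>, \<open>C\<^sub>k = 1 + x D\<^sub>k\<close>.
\<close>

section \<open>Pattern avoidance in terms of subsequences\<close>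

lemma subseq_imp_set_subset: "subseq xs ys \<Longrightarrow> set xs \<subseteq> set ys"
  by (auto simp: subseq_conv_nths dest: in_set_nthsD)

lemma subseq_map_iff: "subseq ys (map f xs) \<longleftrightarrow> (\<exists>zs. subseq zs xs \<and> ys = map f zs)"
  by (auto simp: subseq_conv_nths nths_map)

lemma sorted_wrt_iff_subseq: "sorted_wrt P xs \<longleftrightarrow> (\<forall>a b. subseq [a, b] xs \<longrightarrow> P a b)"
proof (induction xs)
  case (Cons x xs)
  have "subseq [a, b] (x # xs) \<longleftrightarrow> a = x \<and> b \<in> set xs \<or> subseq [a, b] xs" for a b
    by (auto simp: subseq_singleton_left dest: subseq_imp_set_subset)
  with Cons.IH show ?case by auto
qed simp

lemma sorted_wrt_subseq: "subseq xs ys \<Longrightarrow> sorted_wrt P ys \<Longrightarrow> sorted_wrt P xs"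
  unfolding sorted_wrt_iff_subseq by (meson subseq_order.order_trans)

lemma subseq_upt_iff: "subseq is [m..<n] \<longleftrightarrow> sorted_wrt (<) is \<and> set is \<subseteq> {m..<n}"
proof
  assume "subseq is [m..<n]"
  then show "sorted_wrt (<) is \<and> set is \<subseteq> {m..<n}"
    using sorted_wrt_subseq[OF _ sorted_wrt_upt] subseq_imp_set_subset by fastforce
next
  assume "sorted_wrt (<) is \<and> set is \<subseteq> {m..<n}"
  then show "subseq is [m..<n]"
    by (intro sorted_subset_imp_subseq) auto
qed

lemma avoids_iff_subseq: "avoids \<pi> \<tau> \<longleftrightarrow> (\<forall>ys. subseq ys \<pi> \<longrightarrow> \<not> order_isomorphic ys \<tau>)"
proof -
  have "subseq ys \<pi> \<longleftrightarrow>
      (\<exists>is. sorted_wrt (<) is \<and> set is \<subseteq> {..<length \<pi>} \<and> ys = map (\<lambda>i. \<pi> ! i) is)" for ys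
    using subseq_map_iff[of ys "(!) \<pi>" "[0..<length \<pi>]"]
    by (simp add: map_nth subseq_upt_iff lessThan_atLeast0 conj_assoc)
  then show ?thesis
    by (auto simp: avoids_def occurs_at_def)
qed

definition avoids_132 :: "'a::linorder list \<Rightarrow> bool" where
  "avoids_132 xs \<longleftrightarrow> (\<forall>a b c. subseq [a, b, c] xs \<longrightarrow> \<not> (a < c \<and> c < b))"

lemma order_isomorphic_132_iff:
  "order_isomorphic ys [1, 3, 2] \<longleftrightarrow> (\<exists>a b c. ys = [a, b, c] \<and> a < c \<and> c < b)"
proof
  assume iso: "order_isomorphic ys [1, 3, 2]"
  then have "length ys = 3" by (simp add: order_isomorphic_def)
  then obtain a b c where ys: "ys = [a, b, c]"
    by (auto simp: numeral_3_eq_3 length_Suc_conv)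
  have "ys ! 0 < ys ! 2 \<longleftrightarrow> [1, 3, 2 :: nat] ! 0 < [1, 3, 2] ! 2"
    "ys ! 2 < ys ! 1 \<longleftrightarrow> [1, 3, 2 :: nat] ! 2 < [1, 3, 2] ! 1"
    using iso \<open>length ys = 3\<close> unfolding order_isomorphic_def by simp_all
  then show "\<exists>a b c. ys = [a, b, c] \<and> a < c \<and> c < b"
    by (simp add: ys)
next
  assume "\<exists>a b c. ys = [a, b, c] \<and> a < c \<and> c < b"
  then show "order_isomorphic ys [1, 3, 2]"
    by (auto simp: order_isomorphic_def less_Suc_eq)
qed

lemma avoids_132_iff: "avoids \<pi> [1, 3, 2] \<longleftrightarrow> avoids_132 \<pi>"
  unfolding avoids_iff_subseq order_isomorphic_132_iff avoids_132_def by blast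

definition increasing_below :: "nat \<Rightarrow> 'a::linorder list \<Rightarrow> bool" where
  "increasing_below k xs \<longleftrightarrow> (\<forall>ys. subseq ys xs \<longrightarrow> sorted_wrt (<) ys \<longrightarrow> length ys < k)"

lemma order_isomorphic_increasing_iff:
  "order_isomorphic ys [1..<Suc k] \<longleftrightarrow> length ys = k \<and> sorted_wrt (<) ys"
proof
  assume "order_isomorphic ys [1..<Suc k]"
  then show "length ys = k \<and> sorted_wrt (<) ys"
    by (auto simp: order_isomorphic_def sorted_wrt_iff_nth_less simp del: upt_Suc)
next
  assume ys: "length ys = k \<and> sorted_wrt (<) ys"
  then have "ys ! i < ys ! j \<longleftrightarrow> i < j" if "i < k" "j < k" for i j
    using that by (metis linorder_neqE_nat order_less_asym order_less_irrefl sorted_wrt_iff_nth_less)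
  with ys show "order_isomorphic ys [1..<Suc k]"
    by (auto simp: order_isomorphic_def simp del: upt_Suc)
qed

lemma increasing_below_iff_length_neq:
  "increasing_below k xs \<longleftrightarrow> (\<forall>ys. subseq ys xs \<longrightarrow> sorted_wrt (<) ys \<longrightarrow> length ys \<noteq> k)"
proof
  assume neq: "\<forall>ys. subseq ys xs \<longrightarrow> sorted_wrt (<) ys \<longrightarrow> length ys \<noteq> k"
  show "increasing_below k xs"
    unfolding increasing_below_def
  proof (intro allI impI)
    fix ys assume "subseq ys xs" "sorted_wrt (<) ys"
    then have "subseq (take k ys) xs" "sorted_wrt (<) (take k ys)"
      by (meson prefix_imp_subseq sorted_wrt_take subseq_order.order_trans take_is_prefix)+
    then have "length (take k ys) \<noteq> k" using neq by blast
    then show "length ys < k" by simp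
  qed
qed (auto simp: increasing_below_def)

lemma avoids_increasing_iff: "avoids \<pi> [1..<Suc k] \<longleftrightarrow> increasing_below k \<pi>"
  unfolding avoids_iff_subseq order_isomorphic_increasing_iff increasing_below_iff_length_neq
  by blast

section \<open>Removing the maximum of a word\<close>

lemma avoids_132_Nil [simp]: "avoids_132 []"
  by (simp add: avoids_132_def)

lemma avoids_132_Cons:
  "avoids_132 (x # xs) \<longleftrightarrow> avoids_132 xs \<and> sorted_wrt (\<lambda>b c. \<not> (x < c \<and> c < b)) xs"
proof -
  have subseq_iff: "subseq [a, b, c] (x # xs) \<longleftrightarrow> a = x \<and> subseq [b, c] xs \<or> subseq [a, b, c] xs"
    for a b c
    by (auto dest: subseq_Cons')
  show ?thesis
    unfolding avoids_132_def sorted_wrt_iff_subseq subseq_iff by auto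
qed

lemma avoids_132_append:
  assumes "\<And>x y. x \<in> set xs \<Longrightarrow> y \<in> set ys \<Longrightarrow> y \<le> x"
  shows "avoids_132 (xs @ ys) \<longleftrightarrow> avoids_132 xs \<and> avoids_132 ys"
  using assms
proof (induction xs)
  case (Cons x xs)
  have "sorted_wrt (\<lambda>b c. \<not> (x < c \<and> c < b)) ys"
    unfolding sorted_wrt_iff_subseq using Cons.prems
    by (fastforce dest: subseq_imp_set_subset simp: not_less)
  moreover have "\<not> (x < c \<and> c < b)" if "c \<in> set ys" for b c
    using Cons.prems[of x c] that by auto
  ultimately show ?case
    using Cons by (auto simp: avoids_132_Cons sorted_wrt_append)
qed simp

lemma avoids_132_snoc_max:
  "(\<And>x. x \<in> set xs \<Longrightarrow> x \<le> m) \<Longrightarrow> avoids_132 (xs @ [m]) \<longleftrightarrow> avoids_132 xs"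
  by (induction xs) (auto simp: avoids_132_Cons sorted_wrt_append not_less)

lemma avoids_132_append_Cons_maxD:
  assumes "avoids_132 (xs @ m # ys)" "x \<in> set xs" "y \<in> set ys" "y < m"
  shows "y \<le> x"
  using assms by (induction xs) (auto simp: avoids_132_Cons sorted_wrt_append not_less)

lemma avoids_132_map_strict_mono:
  "strict_mono f \<Longrightarrow> avoids_132 (map f xs) \<longleftrightarrow> avoids_132 xs"
  by (induction xs) (simp_all add: avoids_132_Cons sorted_wrt_map strict_mono_less)

lemma increasing_below_append:
  assumes "\<And>x y. x \<in> set xs \<Longrightarrow> y \<in> set ys \<Longrightarrow> y \<le> x"
  shows "increasing_below k (xs @ ys) \<longleftrightarrow> increasing_below k xs \<and> increasing_below k ys"
proof -
  have "subseq zs xs \<or> subseq zs ys" if "subseq zs (xs @ ys)" "sorted_wrt (<) zs" for zs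
  proof -
    obtain ps qs where zs: "zs = ps @ qs" "subseq ps xs" "subseq qs ys"
      using \<open>subseq zs (xs @ ys)\<close> by (rule subseq_appendE)
    have "\<not> p < q" if "p \<in> set ps" "q \<in> set qs" for p q
      using that zs(2,3)[THEN subseq_imp_set_subset] assms by (simp add: not_less subset_iff)
    then have "ps = [] \<or> qs = []"
      using \<open>sorted_wrt (<) zs\<close> by (cases ps; cases qs) (auto simp: zs(1))
    with zs show ?thesis by auto
  qed
  then show ?thesis
    unfolding increasing_below_def by (metis subseq_drop_many subseq_rev_drop_many)
qed

lemma increasing_below_snoc_max:
  assumes max: "\<And>x. x \<in> set xs \<Longrightarrow> x < m"
  shows "increasing_below (Suc k) (xs @ [m]) \<longleftrightarrow> increasing_below k xs"
proof
  assume below: "increasing_below (Suc k) (xs @ [m])"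
  show "increasing_below k xs"
    unfolding increasing_below_def
  proof (intro allI impI)
    fix ys assume ys: "subseq ys xs" "sorted_wrt (<) ys"
    then have "subseq (ys @ [m]) (xs @ [m])" "sorted_wrt (<) (ys @ [m])"
      using max subseq_imp_set_subset[OF ys(1)] by (auto simp: sorted_wrt_append)
    then have "length (ys @ [m]) < Suc k"
      using below unfolding increasing_below_def by blast
    then show "length ys < k" by simp
  qed
next
  assume below: "increasing_below k xs"
  show "increasing_below (Suc k) (xs @ [m])"
    unfolding increasing_below_def
  proof (intro allI impI)
    fix ys assume "subseq ys (xs @ [m])" and sorted: "sorted_wrt (<) ys"
    then obtain ps qs where ys: "ys = ps @ qs" "subseq ps xs" "subseq qs [m]"
      by (metis subseq_appendE)
    have "length ps < k"
      using below sorted ys(1,2) by (auto simp: increasing_below_def sorted_wrt_append)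
    moreover have "length qs \<le> 1" using list_emb_length[OF ys(3)] by simp
    ultimately show "length ys < Suc k" by (simp add: ys(1))
  qed
qed

lemma increasing_below_map_strict_mono:
  "strict_mono f \<Longrightarrow> increasing_below k (map f xs) \<longleftrightarrow> increasing_below k xs"
  unfolding increasing_below_def subseq_map_iff
  by (auto simp: sorted_wrt_map strict_mono_less)

lemma increasing_below_Nil [simp]: "increasing_below k [] \<longleftrightarrow> k > 0"
  by (auto simp: increasing_below_def dest: list_emb_length)

lemma increasing_below_Suc_0_iff: "increasing_below (Suc 0) xs \<longleftrightarrow> xs = []"
proof
  assume below: "increasing_below (Suc 0) xs"
  have "\<not> subseq [x] xs" for x
    using below unfolding increasing_below_def by (auto dest!: spec[of _ "[x]"])
  then have "x \<notin> set xs" for x by (simp add: subseq_singleton_left)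
  then show "xs = []" by (cases xs) auto
qed simp

fun alternating :: "bool \<Rightarrow> 'a::linorder list \<Rightarrow> bool" where
  "alternating up (x # y # xs) \<longleftrightarrow> (if up then x < y else y < x) \<and> alternating (\<not> up) (y # xs)"
| "alternating up _ \<longleftrightarrow> True"

lemma alternating_iff_nth:
  "alternating up xs \<longleftrightarrow> (\<forall>i<length xs - 1.
     if even i = up then xs ! i < xs ! Suc i else xs ! Suc i < xs ! i)"
  by (induction up xs rule: alternating.induct) (auto simp: All_less_Suc2)

lemma alternating_from_up_iff: "alternating_from_up \<pi> \<longleftrightarrow> alternating True \<pi>"
  unfolding alternating_from_up_def alternating_iff_nth by (simp add: less_diff_conv)

lemma alternating_from_down_iff: "alternating_from_down \<pi> \<longleftrightarrow> alternating False \<pi>"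
  unfolding alternating_from_down_def alternating_iff_nth by (auto simp: less_diff_conv)

lemma alternating_map_strict_mono:
  "strict_mono f \<Longrightarrow> alternating up (map f xs) \<longleftrightarrow> alternating up xs"
  by (induction up xs rule: alternating.induct) (auto simp: strict_mono_less)

lemma alternating_append_Cons_max:
  assumes "\<And>x. x \<in> set (xs @ ys) \<Longrightarrow> x < m"
  shows "alternating up (xs @ m # ys) \<longleftrightarrow> alternating up xs \<and> alternating True ys \<and>
    (xs = [] \<and> ys = [] \<or> odd (length xs) = up)"
  using assms
proof (induction up xs rule: alternating.induct)
  case ("2_1" up)
  then show ?case by (cases ys) (auto dest: less_asym)
next
  case ("2_2" up x)
  then show ?case by (cases ys) (auto dest: less_asym)
qed auto

section \<open>Decomposition of 132-avoiding permutations\<close>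

definition perm_word :: "nat list \<Rightarrow> bool" where
  "perm_word \<pi> \<longleftrightarrow> distinct \<pi> \<and> set \<pi> = {1..length \<pi>}"

lemma permutations_of_set_atLeastAtMost:
  "permutations_of_set {1..n} = {\<pi>. perm_word \<pi> \<and> length \<pi> = n}"
proof -
  have "length \<pi> = n" if "distinct \<pi>" "set \<pi> = {1..n}" for \<pi> :: "nat list"
    using distinct_card[OF that(1)] that(2) by simp
  then show ?thesis
    unfolding perm_word_def permutations_of_set_def by blast
qed

lemma perm_word_Nil [simp]: "perm_word []"
  by (simp add: perm_word_def)

lemma perm_word_length_1_iff: "perm_word \<pi> \<and> length \<pi> = 1 \<longleftrightarrow> \<pi> = [1]"
proof
  assume "perm_word \<pi> \<and> length \<pi> = 1"
  moreover from this obtain x where "\<pi> = [x]" by (auto simp: length_Suc_conv)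
  ultimately show "\<pi> = [1]" by (simp add: perm_word_def)
qed (simp add: perm_word_def)

definition skew_sum :: "nat list \<Rightarrow> nat list \<Rightarrow> nat list" where
  "skew_sum u v = map ((+) (length v)) u @ v"

text \<open>The permutation \<open>(u \<oplus> 1) \<ominus> v\<close>.\<close>

definition join_max :: "nat list \<Rightarrow> nat list \<Rightarrow> nat list" where
  "join_max u v = skew_sum (u @ [Suc (length u)]) v"

lemma join_max_eq_append_Cons:
  "join_max u v = map ((+) (length v)) u @ Suc (length u + length v) # v"
  by (simp add: join_max_def skew_sum_def add.commute)

lemma length_join_max [simp]: "length (join_max u v) = Suc (length u + length v)"
  by (simp add: join_max_eq_append_Cons)

lemma join_max_neq_Nil [simp]: "join_max u v \<noteq> []"
  by (simp add: join_max_eq_append_Cons)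

lemma join_max_eq_singleton_iff: "join_max u v = [1] \<longleftrightarrow> u = [] \<and> v = []"
proof
  assume "join_max u v = [1]"
  then have "length (join_max u v) = length [1 :: nat]" by (rule arg_cong)
  then show "u = [] \<and> v = []" by simp
qed (simp add: join_max_eq_append_Cons)

lemma perm_word_snoc_Suc_length_iff: "perm_word (u @ [Suc (length u)]) \<longleftrightarrow> perm_word u"
  unfolding perm_word_def by (auto simp: atLeastAtMostSuc_conv insert_ident)

lemma perm_word_skew_sum:
  assumes "perm_word u" "perm_word v"
  shows "perm_word (skew_sum u v)"
proof -
  have "set (skew_sum u v) = {length v + 1..length u + length v} \<union> {1..length v}"
    using assms by (simp add: perm_word_def skew_sum_def)
  also have "\<dots> = {1..length (skew_sum u v)}" by (auto simp: skew_sum_def)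
  finally show ?thesis
    using assms by (auto simp: perm_word_def skew_sum_def distinct_map)
qed

lemma perm_word_join_max: "perm_word u \<Longrightarrow> perm_word v \<Longrightarrow> perm_word (join_max u v)"
  by (simp add: join_max_def perm_word_skew_sum perm_word_snoc_Suc_length_iff)

lemma perm_word_less_shifted:
  assumes "perm_word u" "perm_word v" "x \<in> set (map ((+) (length v)) u)" "y \<in> set v"
  shows "y < x"
  using assms by (auto simp: perm_word_def)

lemma perm_word_less_Suc_length: "perm_word u \<Longrightarrow> x \<in> set u \<Longrightarrow> x < Suc (length u)"
  by (simp add: perm_word_def)

lemma strict_mono_plus_nat: "strict_mono ((+) (c :: nat))"
  by (simp add: strict_mono_def)

lemma avoids_132_skew_sum:
  assumes "perm_word u" "perm_word v"
  shows "avoids_132 (skew_sum u v) \<longleftrightarrow> avoids_132 u \<and> avoids_132 v"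
  unfolding skew_sum_def
  using avoids_132_append[of "map ((+) (length v)) u" v,
      OF less_imp_le[OF perm_word_less_shifted[OF assms]]]
  by (simp add: avoids_132_map_strict_mono[OF strict_mono_plus_nat])

lemma avoids_132_join_max:
  assumes "perm_word u" "perm_word v"
  shows "avoids_132 (join_max u v) \<longleftrightarrow> avoids_132 u \<and> avoids_132 v"
  using avoids_132_snoc_max[OF less_imp_le[OF perm_word_less_Suc_length[OF assms(1)]]] assms
  by (simp add: join_max_def avoids_132_skew_sum perm_word_snoc_Suc_length_iff)

lemma increasing_below_skew_sum:
  assumes "perm_word u" "perm_word v"
  shows "increasing_below k (skew_sum u v) \<longleftrightarrow> increasing_below k u \<and> increasing_below k v"
  unfolding skew_sum_def
  using increasing_below_append[of "map ((+) (length v)) u" v,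
      OF less_imp_le[OF perm_word_less_shifted[OF assms]]]
  by (simp add: increasing_below_map_strict_mono[OF strict_mono_plus_nat])

lemma increasing_below_join_max:
  assumes "perm_word u" "perm_word v"
  shows "increasing_below (Suc k) (join_max u v) \<longleftrightarrow>
    increasing_below k u \<and> increasing_below (Suc k) v"
  using increasing_below_snoc_max[OF perm_word_less_Suc_length[OF assms(1)]] assms
  by (simp add: join_max_def increasing_below_skew_sum perm_word_snoc_Suc_length_iff)

lemma alternating_join_max:
  assumes "perm_word u" "perm_word v"
  shows "alternating up (join_max u v) \<longleftrightarrow> alternating up u \<and> alternating True v \<and>
    (u = [] \<and> v = [] \<or> odd (length u) = up)"
proof -
  have "x < Suc (length u + length v)" if "x \<in> set (map ((+) (length v)) u @ v)" for x
    using that assms by (auto simp: perm_word_def)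
  from alternating_append_Cons_max[of "map ((+) (length v)) u" v, OF this] show ?thesis
    unfolding join_max_eq_append_Cons
    by (simp add: alternating_map_strict_mono[OF strict_mono_plus_nat])
qed

lemma inj_on_join_max: "inj_on (case_prod join_max) (Collect perm_word \<times> Collect perm_word)"
proof (rule inj_onI, clarsimp)
  fix u v u' v'
  assume perm: "perm_word u" "perm_word v" "perm_word u'" "perm_word v'"
    and eq: "join_max u v = join_max u' v'"
  have length: "length u' + length v' = length u + length v"
    using arg_cong[OF eq, of length] by simp
  define m where "m = Suc (length u + length v)"
  have "map ((+) (length v)) u @ m # v = map ((+) (length v')) u' @ m # v'"
    using eq by (simp add: join_max_eq_append_Cons length m_def)
  moreover have "m \<notin> set (map ((+) (length v)) u)" "m \<notin> set v"
    using perm by (auto simp: perm_word_def m_def)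
  ultimately show "u = u' \<and> v = v'"
    by (auto simp: append_Cons_eq_iff)
qed

lemma lower_set_eq_atLeastAtMost_card:
  fixes A :: "nat set"
  assumes "finite A" "0 \<notin> A" and lower: "\<And>x y. y \<in> A \<Longrightarrow> 1 \<le> x \<Longrightarrow> x \<le> y \<Longrightarrow> x \<in> A"
  shows "A = {1..card A}"
proof (cases "A = {}")
  case False
  have "A = {1..Max A}"
  proof (intro equalityI subsetI)
    fix x assume "x \<in> A"
    then show "x \<in> {1..Max A}"
      using assms(1,2) by (cases x) auto
  next
    fix x assume "x \<in> {1..Max A}"
    then show "x \<in> A"
      using lower[OF Max_in] \<open>finite A\<close> False by auto
  qed
  then show ?thesis
    by (metis card_atLeastAtMost diff_Suc_1)
qed simp

lemma perm_word_append_decompose_skew: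
  assumes perm: "perm_word (xs @ ys)" and less: "\<And>x y. x \<in> set xs \<Longrightarrow> y \<in> set ys \<Longrightarrow> y < x"
  obtains u where "perm_word u" "perm_word ys" "xs = map ((+) (length ys)) u"
proof -
  have sets: "set xs \<union> set ys = {1..length xs + length ys}"
    and dist: "distinct xs" "distinct ys" "set xs \<inter> set ys = {}"
    using perm by (auto simp: perm_word_def)
  have "set ys = {1..card (set ys)}"
  proof (rule lower_set_eq_atLeastAtMost_card)
    fix x y assume "y \<in> set ys" "1 \<le> x" "x \<le> y"
    moreover have "y \<in> {1..length xs + length ys}"
      using \<open>y \<in> set ys\<close> sets by blast
    ultimately have "x \<in> set xs \<union> set ys"
      by (simp add: sets)
    then show "x \<in> set ys"
      using less[of x y] \<open>y \<in> set ys\<close> \<open>x \<le> y\<close> by auto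
  qed (use sets in force)+
  then have ys: "set ys = {1..length ys}"
    using dist by (simp add: distinct_card)
  have "set xs = {1..length xs + length ys} - {1..length ys}"
    using sets dist(3) ys by blast
  also have "\<dots> = (+) (length ys) ` {1..length xs}"
    by auto
  finally have xs: "set xs = (+) (length ys) ` {1..length xs}" .
  then have "xs \<in> lists ((+) (length ys) ` {1..length xs})"
    by (simp add: lists_eq_set)
  then obtain u where u: "xs = map ((+) (length ys)) u"
    unfolding lists_image by blast
  have "(+) (length ys) ` set u = (+) (length ys) ` {1..length u}"
    using xs unfolding u set_map length_map .
  then have "set u = {1..length u}"
    by (simp only: inj_image_eq_iff[OF inj_on_add])
  then have "perm_word u"
    using dist(1) by (simp add: perm_word_def u distinct_map)
  with u ys dist(2) that show ?thesis
    by (simp add: perm_word_def)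
qed

lemma perm_word_decompose_132:
  assumes perm: "perm_word \<pi>" and "avoids_132 \<pi>" "\<pi> \<noteq> []"
  obtains u v where "perm_word u" "perm_word v" "\<pi> = join_max u v"
proof -
  define m where "m = length \<pi>"
  have "m \<in> set \<pi>" using assms by (simp add: perm_word_def m_def Suc_leI)
  then obtain xs v where \<pi>: "\<pi> = xs @ m # v" by (meson split_list)
  have range: "set (xs @ m # v) = {1..m}" and "distinct (xs @ m # v)"
    using perm unfolding perm_word_def m_def[symmetric] \<pi>[symmetric] by auto
  then have disjoint: "set xs \<inter> set v = {}" "m \<notin> set v" by auto
  have "y < x" if "x \<in> set (xs @ [m])" "y \<in> set v" for x y
  proof -
    have "y \<in> {1..m}" using \<open>y \<in> set v\<close> range by auto
    then have "y < m" using \<open>y \<in> set v\<close> disjoint by (cases "y = m") auto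
    moreover have "y \<le> x" if "x \<in> set xs"
      using avoids_132_append_Cons_maxD[OF _ that \<open>y \<in> set v\<close> \<open>y < m\<close>] assms(2) \<pi> by simp
    ultimately show ?thesis
      using that disjoint by (cases "x = m") (auto simp: order_less_le)
  qed
  moreover have "perm_word ((xs @ [m]) @ v)" using perm \<pi> by simp
  ultimately obtain w where w: "perm_word w" "perm_word v" "xs @ [m] = map ((+) (length v)) w"
    using perm_word_append_decompose_skew by blast
  then obtain u a where u: "w = u @ [a]" "xs = map ((+) (length v)) u" "m = length v + a"
    by (auto simp: append_eq_map_conv)
  have "m = Suc (length u + length v)"
    unfolding m_def by (simp only: \<pi> u(2) length_append length_map length_Cons add_Suc_right)
  then have "a = Suc (length u)" using u(3) by simp
  with w u have "perm_word u" "\<pi> = join_max u v"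
    unfolding \<pi> by (simp_all add: perm_word_snoc_Suc_length_iff join_max_def skew_sum_def)
  with w(2) that show ?thesis by blast
qed

section \<open>Generating functions of sets of words\<close>

definition level :: "'a list set \<Rightarrow> nat \<Rightarrow> 'a list set" where
  "level S n = {xs \<in> S. length xs = n}"

definition length_gf :: "'a list set \<Rightarrow> real fls" where
  "length_gf S = gen_fun (\<lambda>n. card (level S n))"

lemma length_gf_empty [simp]: "length_gf {} = 0"
  by (simp add: length_gf_def level_def gen_fun_def flip: fps_zero_def)

lemma length_gf_insert:
  assumes "xs \<notin> S" "\<And>n. finite (level S n)"
  shows "length_gf (insert xs S) = fls_X ^ length xs + length_gf S"
proof -
  have level: "level (insert xs S) n =
      (if n = length xs then insert xs (level S n) else level S n)" for n
    by (auto simp: level_def)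
  have "xs \<notin> level S n" for n
    using assms(1) by (simp add: level_def)
  then have "Abs_fps (\<lambda>n. real (card (level (insert xs S) n))) =
      fps_X ^ length xs + Abs_fps (\<lambda>n. real (card (level S n)))"
    using assms(2) by (simp add: fps_eq_iff level)
  then show ?thesis
    by (simp add: length_gf_def gen_fun_def fps_to_fls_power)
qed

lemma gen_fun_X_mult_convolution:
  assumes "c 0 = 0" "\<And>n. c (Suc n) = (\<Sum>i\<le>n. a i * b (n - i))"
  shows "gen_fun c = fls_X * (gen_fun a * gen_fun b)"
proof -
  let ?F = "\<lambda>f. Abs_fps (\<lambda>n. real (f n))"
  have "(?F a * ?F b) $ n = (\<Sum>i\<le>n. real (a i) * real (b (n - i)))" for n
    by (simp add: fps_mult_nth atLeast0AtMost)
  then have "?F c $ n = (fps_X * (?F a * ?F b)) $ n" for n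
    by (cases n) (simp_all add: assms)
  then have "?F c = fps_X * (?F a * ?F b)"
    by (rule fps_ext)
  then show ?thesis
    by (simp add: gen_fun_def fls_times_fps_to_fls)
qed

lemma length_gf_image_Times:
  assumes inj: "inj_on (case_prod f) (S \<times> T)"
    and length: "\<And>u v. u \<in> S \<Longrightarrow> v \<in> T \<Longrightarrow> length (f u v) = Suc (length u + length v)"
    and fin: "\<And>n. finite (level S n)" "\<And>n. finite (level T n)"
  shows "length_gf (case_prod f ` (S \<times> T)) = fls_X * (length_gf S * length_gf T)"
  unfolding length_gf_def
proof (rule gen_fun_X_mult_convolution)
  show "card (level (case_prod f ` (S \<times> T)) 0) = 0"
    using length by (fastforce simp: level_def card_eq_0_iff simp del: length_0_conv)
next
  fix n
  let ?P = "SIGMA i:{..n}. level S i \<times> level T (n - i)"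
  have "level (case_prod f ` (S \<times> T)) (Suc n) = (\<lambda>(i, u, v). f u v) ` ?P"
    by (auto simp: level_def length image_iff) (metis add_diff_cancel_left' atMost_iff le_add1)
  moreover have "inj_on (\<lambda>(i, u, v). f u v) ?P"
    using inj by (auto simp: inj_on_def level_def)
  ultimately show "card (level (case_prod f ` (S \<times> T)) (Suc n)) =
      (\<Sum>i\<le>n. card (level S i) * card (level T (n - i)))"
    using fin by (simp add: card_image card_cartesian_product)
qed

section \<open>Alternating avoiders\<close>

definition alt_avoiders :: "nat \<Rightarrow> bool \<Rightarrow> bool \<Rightarrow> nat list set" where
  "alt_avoiders k up is_odd = {\<pi>. perm_word \<pi> \<and> avoids_132 \<pi> \<and> increasing_below k \<pi> \<and>
     alternating up \<pi> \<and> odd (length \<pi>) = is_odd}"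

abbreviation alt_gf :: "nat \<Rightarrow> bool \<Rightarrow> bool \<Rightarrow> real fls" where
  "alt_gf k up is_odd \<equiv> length_gf (alt_avoiders k up is_odd)"

abbreviation odd_up_gf :: "nat \<Rightarrow> real fls" where "odd_up_gf k \<equiv> alt_gf k True True"
abbreviation even_up_gf :: "nat \<Rightarrow> real fls" where "even_up_gf k \<equiv> alt_gf k True False"
abbreviation odd_down_gf :: "nat \<Rightarrow> real fls" where "odd_down_gf k \<equiv> alt_gf k False True"
abbreviation even_down_gf :: "nat \<Rightarrow> real fls" where "even_down_gf k \<equiv> alt_gf k False False"

lemma finite_level_perm_words:
  assumes "S \<subseteq> Collect perm_word"
  shows "finite (level S n)"
proof (rule finite_subset)
  show "level S n \<subseteq> permutations_of_set {1..n}"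
    using assms unfolding level_def permutations_of_set_atLeastAtMost by blast
qed simp

lemma join_max_in_alt_avoiders_iff:
  assumes "perm_word u" "perm_word v" "k > 0"
  shows "join_max u v \<in> alt_avoiders (Suc k) up is_odd \<longleftrightarrow>
    u = [] \<and> v = [] \<and> up \<and> is_odd \<or>
    u \<in> alt_avoiders k up up \<and> v \<in> alt_avoiders (Suc k) True (is_odd = up)"
  using assms
  by (auto simp: alt_avoiders_def perm_word_join_max avoids_132_join_max
      increasing_below_join_max alternating_join_max)

lemma alt_avoiders_Suc:
  assumes "k > 0"
  shows "alt_avoiders (Suc k) up is_odd =
    (if is_odd then if up then {[1]} else {} else {[]}) \<union>
    case_prod join_max ` (alt_avoiders k up up \<times> alt_avoiders (Suc k) True (is_odd = up))"
    (is "?L = ?E \<union> ?J")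
proof (intro equalityI subsetI)
  fix \<pi> assume \<pi>: "\<pi> \<in> ?L"
  show "\<pi> \<in> ?E \<union> ?J"
  proof (cases "\<pi> = []")
    case True
    then show ?thesis using \<pi> by (auto simp: alt_avoiders_def)
  next
    case False
    then obtain u v where "perm_word u" "perm_word v" "\<pi> = join_max u v"
      using perm_word_decompose_132 \<pi> unfolding alt_avoiders_def by blast
    then show ?thesis
      using \<pi> assms join_max_eq_singleton_iff[of u v] by (auto simp: join_max_in_alt_avoiders_iff)
  qed
next
  have "[1] \<in> alt_avoiders (Suc k) True True"
    using join_max_in_alt_avoiders_iff[of "[]" "[]" k True True]
      join_max_eq_singleton_iff[of "[]" "[]"] assms by simp
  moreover have "[] \<in> alt_avoiders (Suc k) up False"
    by (simp add: alt_avoiders_def)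
  moreover have "join_max u v \<in> ?L"
    if "u \<in> alt_avoiders k up up" "v \<in> alt_avoiders (Suc k) True (is_odd = up)" for u v
    using that assms join_max_in_alt_avoiders_iff[of u v k up is_odd] by (simp add: alt_avoiders_def)
  ultimately show "\<pi> \<in> ?L" if "\<pi> \<in> ?E \<union> ?J" for \<pi>
    using that by (auto split: if_splits)
qed

lemma alt_gf_Suc:
  assumes "k > 0"
  shows "alt_gf (Suc k) up is_odd = (if is_odd then if up then fls_X else 0 else 1) +
    fls_X * (alt_gf k up up * alt_gf (Suc k) True (is_odd = up))"
proof -
  define joins where
    "joins = case_prod join_max ` (alt_avoiders k up up \<times> alt_avoiders (Suc k) True (is_odd = up))"
  have perm: "alt_avoiders i b c \<subseteq> Collect perm_word" for i b c
    by (auto simp: alt_avoiders_def)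
  have length_gf_joins: "length_gf joins = fls_X * (alt_gf k up up * alt_gf (Suc k) True (is_odd = up))"
    unfolding joins_def
    by (intro length_gf_image_Times inj_on_subset[OF inj_on_join_max] Sigma_mono perm
        finite_level_perm_words) simp
  have finite: "finite (level joins n)" for n
    unfolding joins_def
    by (intro finite_level_perm_words) (auto simp: alt_avoiders_def perm_word_join_max)
  have Nil: "[] \<notin> joins"
    unfolding joins_def by (auto simp: join_max_neq_Nil[symmetric])
  have singleton: "[1] \<notin> joins" if up
  proof
    assume "[1] \<in> joins"
    then obtain u v where "u \<in> alt_avoiders k up up" "join_max u v = [1]"
      unfolding joins_def by auto
    then have "[] \<in> alt_avoiders k up up" using join_max_eq_singleton_iff[of u v] by simp
    then show False using that by (simp add: alt_avoiders_def)
  qed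
  have "alt_avoiders (Suc k) up is_odd =
      (if is_odd then if up then {[1]} else {} else {[]}) \<union> joins"
    unfolding joins_def by (rule alt_avoiders_Suc[OF assms])
  then show ?thesis
    using length_gf_insert[OF Nil finite] length_gf_insert[OF singleton finite] length_gf_joins by simp
qed

lemma alt_gf_Suc_0: "alt_gf (Suc 0) up is_odd = (if is_odd then 0 else 1)"
proof -
  have "alt_avoiders (Suc 0) up is_odd = (if is_odd then {} else {[]})"
    by (auto simp: alt_avoiders_def increasing_below_Suc_0_iff)
  then show ?thesis
    by (simp add: length_gf_insert level_def)
qed

lemma
  assumes "k > 0"
  shows odd_up_gf_Suc: "odd_up_gf (Suc k) = fls_X + fls_X * (odd_up_gf k * odd_up_gf (Suc k))"
    and even_up_gf_Suc: "even_up_gf (Suc k) = 1 + fls_X * (odd_up_gf k * even_up_gf (Suc k))"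
    and even_down_gf_Suc: "even_down_gf (Suc k) = 1 + fls_X * (even_down_gf k * odd_up_gf (Suc k))"
    and odd_down_gf_Suc: "odd_down_gf (Suc k) = fls_X * (even_down_gf k * even_up_gf (Suc k))"
  using alt_gf_Suc[OF assms, of True True] alt_gf_Suc[OF assms, of True False]
    alt_gf_Suc[OF assms, of False False] alt_gf_Suc[OF assms, of False True] by simp_all

lemma odd_up_gf_mult_cheb_U_at:
  "k \<ge> 1 \<Longrightarrow> odd_up_gf k * cheb_U_at (int k - 1) = cheb_U_at (int k - 2)"
proof (induction k rule: nat_induct_at_least)
  case base
  show ?case by (simp add: alt_gf_Suc_0 cheb_U_at_def cheb_U_minus_1)
next
  case (Suc k)
  have "fls_X * (odd_up_gf (Suc k) * cheb_U_at (int k)) =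
      odd_up_gf (Suc k) * (cheb_U_at (int k - 1) - fls_X * cheb_U_at (int k - 2))"
    using cheb_U_at_rec[of "int k"] \<open>k \<ge> 1\<close> by (simp add: mult.left_commute)
  also have "\<dots> = (odd_up_gf (Suc k) - fls_X * (odd_up_gf k * odd_up_gf (Suc k))) *
      cheb_U_at (int k - 1)"
    unfolding Suc.IH[symmetric] by (simp add: algebra_simps)
  also have "odd_up_gf (Suc k) - fls_X * (odd_up_gf k * odd_up_gf (Suc k)) = fls_X"
    using odd_up_gf_Suc[of k] \<open>k \<ge> 1\<close> by (simp add: algebra_simps)
  finally show ?case by simp
qed

lemma even_down_gf_mult_cheb_U_at:
  "k \<ge> 1 \<Longrightarrow>
    fls_X * even_down_gf k * cheb_U_at (int k - 1) = cheb_U_at (int k - 2) + fls_X ^ k"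
proof (induction k rule: nat_induct_at_least)
  case base
  show ?case by (simp add: alt_gf_Suc_0 cheb_U_at_def cheb_U_minus_1 cheb_U_0)
next
  case (Suc k)
  have "fls_X * even_down_gf (Suc k) * cheb_U_at (int k) = fls_X * cheb_U_at (int k) +
      fls_X * (fls_X * even_down_gf k * (odd_up_gf (Suc k) * cheb_U_at (int k)))"
    using even_down_gf_Suc[of k] \<open>k \<ge> 1\<close> by (simp add: algebra_simps)
  also have "odd_up_gf (Suc k) * cheb_U_at (int k) = cheb_U_at (int k - 1)"
    using odd_up_gf_mult_cheb_U_at[of "Suc k"] by simp
  also have "fls_X * cheb_U_at (int k) + fls_X * (fls_X * even_down_gf k * cheb_U_at (int k - 1)) =
      cheb_U_at (int k - 1) + fls_X ^ Suc k"
    unfolding Suc.IH using cheb_U_at_rec[of "int k"] \<open>k \<ge> 1\<close> by (simp add: algebra_simps)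
  finally show ?case by simp
qed

lemma odd_up_gf_eq_X_mult_even_up_gf:
  assumes "k > 0"
  shows "odd_up_gf (Suc k) = fls_X * even_up_gf (Suc k)"
proof -
  define denom where "denom = 1 - fls_X * odd_up_gf k"
  have odd: "odd_up_gf (Suc k) * denom = fls_X" and even: "even_up_gf (Suc k) * denom = 1"
    using odd_up_gf_Suc[OF assms] even_up_gf_Suc[OF assms]
    by (simp_all add: denom_def algebra_simps)
  have "odd_up_gf (Suc k) = odd_up_gf (Suc k) * (even_up_gf (Suc k) * denom)"
    by (simp add: even)
  also have "\<dots> = fls_X * even_up_gf (Suc k)"
    unfolding odd[symmetric] by (simp only: mult_ac)
  finally show ?thesis .
qed

lemma even_down_gf_eq_1_plus_X_mult_odd_down_gf:
  assumes "k > 0"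
  shows "even_down_gf (Suc k) = 1 + fls_X * odd_down_gf (Suc k)"
proof -
  have "even_down_gf (Suc k) = 1 + fls_X * (even_down_gf k * odd_up_gf (Suc k))"
    by (rule even_down_gf_Suc[OF assms])
  also have "even_down_gf k * odd_up_gf (Suc k) = fls_X * (even_down_gf k * even_up_gf (Suc k))"
    unfolding odd_up_gf_eq_X_mult_even_up_gf[OF assms] by (rule mult.left_commute)
  also have "\<dots> = odd_down_gf (Suc k)"
    by (rule odd_down_gf_Suc[OF assms, symmetric])
  finally show ?thesis .
qed

section \<open>Up-down, up-up, down-up and down-down permutations\<close>

lemma gen_fun_alternating_avoiders:
  assumes "k \<ge> 2"
    and class_iff: "\<And>\<pi>. P \<pi> \<longleftrightarrow> length \<pi> \<ge> 2 \<and> odd (length \<pi>) = is_odd \<and> alternating up \<pi>"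
  shows "gen_fun (\<lambda>n. card {\<pi> \<in> avoiders k n. P \<pi>}) =
    alt_gf k up is_odd - (if is_odd then fls_X else 1)"
proof -
  let ?S = "{\<pi> \<in> alt_avoiders k up is_odd. length \<pi> \<ge> 2}"
  let ?small = "if is_odd then [1] else [] :: nat list"
  have level: "{\<pi> \<in> avoiders k n. P \<pi>} = level ?S n" for n
    unfolding avoiders_def permutations_of_set_atLeastAtMost avoids_132_iff avoids_increasing_iff
    by (auto simp: class_iff level_def alt_avoiders_def)
  have "\<pi> = ?small" if "\<pi> \<in> alt_avoiders k up is_odd" "length \<pi> < 2" for \<pi>
    using that perm_word_length_1_iff[of \<pi>] by (auto simp: alt_avoiders_def less_2_cases_iff)
  moreover have "increasing_below k [1 :: nat]"
    using increasing_below_snoc_max[of "[]" "1 :: nat" "k - 1"] \<open>k \<ge> 2\<close> by simp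
  then have "?small \<in> alt_avoiders k up is_odd"
    using \<open>k \<ge> 2\<close> by (simp add: alt_avoiders_def avoids_132_Cons perm_word_def)
  ultimately have "alt_avoiders k up is_odd = insert ?small ?S"
    by (blast intro: leI)
  moreover have "finite (level ?S n)" for n
    by (rule finite_level_perm_words) (auto simp: alt_avoiders_def)
  ultimately have "alt_gf k up is_odd = fls_X ^ length ?small + length_gf ?S"
    using length_gf_insert[of ?small ?S] by simp
  then show ?thesis
    unfolding level length_gf_def by simp
qed

lemma
  shows up_down_iff: "up_down \<pi> \<longleftrightarrow> length \<pi> \<ge> 2 \<and> odd (length \<pi>) = True \<and> alternating True \<pi>"
    and up_up_iff: "up_up \<pi> \<longleftrightarrow> length \<pi> \<ge> 2 \<and> odd (length \<pi>) = False \<and> alternating True \<pi>"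
    and down_up_iff:
      "down_up \<pi> \<longleftrightarrow> length \<pi> \<ge> 2 \<and> odd (length \<pi>) = True \<and> alternating False \<pi>"
    and down_down_iff:
      "down_down \<pi> \<longleftrightarrow> length \<pi> \<ge> 2 \<and> odd (length \<pi>) = False \<and> alternating False \<pi>"
  by (simp_all add: up_down_def up_up_def down_up_def down_down_def
      alternating_from_up_iff alternating_from_down_iff)

lemma
  assumes "k \<ge> 2"
  shows gen_fun_ud: "gen_fun (ud k) = odd_up_gf k - fls_X"
    and gen_fun_uu: "gen_fun (uu k) = even_up_gf k - 1"
    and gen_fun_du: "gen_fun (du k) = odd_down_gf k - fls_X"
    and gen_fun_dd: "gen_fun (dd k) = even_down_gf k - 1"
  unfolding ud_def uu_def du_def dd_def
  using gen_fun_alternating_avoiders[OF assms up_down_iff]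
    gen_fun_alternating_avoiders[OF assms up_up_iff]
    gen_fun_alternating_avoiders[OF assms down_up_iff]
    gen_fun_alternating_avoiders[OF assms down_down_iff] by simp_all

lemma gen_fun_ud_eq_X_mult_gen_fun_uu:
  assumes "k \<ge> 2"
  shows "gen_fun (ud k) = fls_X * gen_fun (uu k)"
  using odd_up_gf_eq_X_mult_even_up_gf[of "k - 1"] assms
  by (simp add: gen_fun_ud gen_fun_uu algebra_simps)

lemma gen_fun_dd_eq_X_mult_gen_fun_du_plus_X:
  assumes "k \<ge> 2"
  shows "gen_fun (dd k) = fls_X * (gen_fun (du k) + fls_X)"
  using even_down_gf_eq_1_plus_X_mult_odd_down_gf[of "k - 1"] assms
  by (simp add: gen_fun_dd gen_fun_du)

theorem theorem2p4:
  fixes k :: nat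
  assumes "k \<ge> 2"
  shows "gen_fun (ud k) = fls_X * cheb_U_at (int k - 3) / cheb_U_at (int k - 1)
    \<and> gen_fun (dd k) = (fls_X ^ (k - 1) + cheb_U_at (int k - 3)) / cheb_U_at (int k - 1)
    \<and> gen_fun (uu k) = cheb_U_at (int k - 3) / cheb_U_at (int k - 1)
    \<and> gen_fun (du k) = (fls_X ^ (k - 1) + cheb_U_at (int k - 3)) / (fls_X * cheb_U_at (int k - 1)) - fls_X"
proof -
  define U V where "U = cheb_U_at (int k - 1)" and "V = cheb_U_at (int k - 3)"
  have U_nonzero: "U \<noteq> 0" "fls_X * U \<noteq> 0"
    using cheb_U_at_nonzero[of "k - 1"] assms by (simp_all add: U_def)
  have U_rec: "fls_X * U = cheb_U_at (int k - 2) - fls_X * V"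
    using cheb_U_at_rec[of "int k - 1"] assms by (simp add: U_def V_def)
  have ud: "gen_fun (ud k) * U = fls_X * V"
    using odd_up_gf_mult_cheb_U_at[of k] U_rec assms
    by (simp add: gen_fun_ud algebra_simps flip: U_def)
  then have uu: "gen_fun (uu k) * U = V"
    by (simp add: gen_fun_ud_eq_X_mult_gen_fun_uu[OF assms] mult.assoc)
  have "fls_X * (gen_fun (dd k) * U) = fls_X * (fls_X ^ (k - 1) + V)"
    using even_down_gf_mult_cheb_U_at[of k] U_rec assms power_eq_if[of "fls_X :: real fls" k]
    by (simp add: gen_fun_dd algebra_simps flip: U_def)
  then have dd: "gen_fun (dd k) * U = fls_X ^ (k - 1) + V"
    by (simp only: mult_cancel_left fls_X_nonzero simp_thms)
  then have du: "(gen_fun (du k) + fls_X) * (fls_X * U) = fls_X ^ (k - 1) + V"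
    by (simp only: gen_fun_dd_eq_X_mult_gen_fun_du_plus_X[OF assms] mult_ac)
  show ?thesis
    unfolding U_def[symmetric] V_def[symmetric]
    using ud dd uu du U_nonzero by (simp only: eq_diff_eq nonzero_eq_divide_eq simp_thms)
qed

end
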